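(* The generating function $$A(x;p,1;v):=\sum_{i\ge1}\sum_{n\ge1}x^n\sum_{w\in\mathcal{M}_{n,i}}p^{\mathrm{sper}(w)}v^{i-1}$$ for the number of nonempty Motzkin polyominoes according to the length, the semiperimeter, and the value of the last letter (a last letter equal to $i$ being recorded by $v^{i-1}$) is given by $$A(x;p,1;v)=\frac{1 + p^2 (x - 2 v x)-\sqrt{1 - 2 p^2 x - 4 p^3 x^2 + p^4 x^2}}{2 (1 + p x + p^2 v^2 x - v (1 + p^2 x))}.$$
   Context: A Motzkin word of length $n\ge 1$ is a word $w=w_1\cdots w_n$ over the positive integers such that $w_1=1$, and $1\le w_k\le w_{k-1}+1$ and $w_{k-1}\ne w_k$ for $k=2,\dots,n$; $\mathcal{M}_{n,i}$ is the set of Motzkin words of length $n$ whose last symbol is $i$. To $w$ one associates the Motzkin polyomino $P(w)$ with $n$ columns, all bottom-justified, whose $i$-th column consists of $w_i$ unit cells. The perimeter of $P(w)$ is the number of (unit) cell borders that do not touch another cell of $P(w)$, and the semiperimeter $\mathrm{sper}(w)$ is half of the perimeter. *)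

theory Defs
  imports Complex_Main "HOL-Library.Product_Plus" "HOL-Computational_Algebra.Formal_Power_Series"
begin

section \<open>Motzkin words and Motzkin polyominoes\<close>

text \<open>A word is a list of naturals, so the letter called \<open>w_k\<close> on paper is \<open>w ! (k - 1)\<close>.\<close>

definition motzkin_word :: "nat list \<Rightarrow> bool" where
  "motzkin_word w \<longleftrightarrow> w \<noteq> [] \<and> w ! 0 = 1 \<and>
     (\<forall>k. 1 \<le> k \<and> k < length w \<longrightarrow>
        1 \<le> w ! k \<and> w ! k \<le> w ! (k - 1) + 1 \<and> w ! (k - 1) \<noteq> w ! k)"

definition motzkin_words :: "nat \<Rightarrow> nat \<Rightarrow> nat list set" where
  "motzkin_words n i = {w. motzkin_word w \<and> length w = n \<and> last w = i}"

text \<open>A unit cell is named by its lower left corner; the bottom row lies at height 0.\<close>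

definition polyomino :: "nat list \<Rightarrow> (int \<times> int) set" where
  "polyomino w = {(int k, int j) | k j. k < length w \<and> j < w ! k}"

definition neighbours :: "int \<times> int \<Rightarrow> (int \<times> int) set" where
  "neighbours c = {(fst c + 1, snd c), (fst c - 1, snd c), (fst c, snd c + 1), (fst c, snd c - 1)}"

text \<open>The border between a cell \<open>c\<close> and an adjacent square \<open>d\<close> is encoded by the pair
  \<open>(c, d)\<close>; it counts towards the perimeter iff \<open>d\<close> is not a cell of the polyomino.\<close>

definition perimeter :: "(int \<times> int) set \<Rightarrow> nat" where
  "perimeter P = card {(c, d). c \<in> P \<and> d \<in> neighbours c \<and> d \<notin> P}"

text \<open>The division is exact, see \<open>even_perimeter\<close> below.\<close>

definition sper :: "nat list \<Rightarrow> nat" where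
  "sper w = perimeter (polyomino w) div 2"

lemma finite_polyomino: "finite (polyomino w)"
proof -
  have "polyomino w = (\<lambda>(k, j). (int k, int j)) ` (SIGMA k:{..<length w}. {..<w ! k})"
    by (force simp: polyomino_def)
  then show ?thesis by simp
qed

lemma card_exits_opposite:
  fixes P :: "'a::ab_group_add set"
  assumes "finite P"
  shows "card {c \<in> P. c + e \<notin> P} = card {c \<in> P. c - e \<notin> P}"
proof -
  have "bij_betw (\<lambda>c. c + e) {c \<in> P. c + e \<in> P} {c \<in> P. c - e \<in> P}"
    by (rule bij_betwI[where g = "\<lambda>c. c - e"]) auto
  then have eq: "card {c \<in> P. c + e \<in> P} = card {c \<in> P. c - e \<in> P}"
    by (rule bij_betw_same_card)
  have split: "card P = card {c \<in> P. Q c} + card {c \<in> P. \<not> Q c}" for Q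
  proof -
    have "card ({c \<in> P. Q c} \<union> {c \<in> P. \<not> Q c}) = card {c \<in> P. Q c} + card {c \<in> P. \<not> Q c}"
      using assms by (intro card_Un_disjoint) auto
    moreover have "{c \<in> P. Q c} \<union> {c \<in> P. \<not> Q c} = P" by auto
    ultimately show ?thesis by simp
  qed
  show ?thesis using split[of "\<lambda>c. c + e \<in> P"] split[of "\<lambda>c. c - e \<in> P"] eq by simp
qed

lemma even_perimeter: "even (perimeter (polyomino w))"
proof -
  define P where "P = polyomino w"
  define X where "X a b = (\<lambda>c. (c, (fst c + a, snd c + b))) `
    {c \<in> P. (fst c + a, snd c + b) \<notin> P}" for a b :: int
  have fin: "finite P" unfolding P_def by (rule finite_polyomino)
  have finX: "finite (X a b)" for a b using fin by (simp add: X_def)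
  have cardX: "card (X a b) = card {c \<in> P. (fst c + a, snd c + b) \<notin> P}" for a b
    unfolding X_def by (intro card_image inj_onI) auto
  have eq: "{(c, d). c \<in> P \<and> d \<in> neighbours c \<and> d \<notin> P}
      = X 1 0 \<union> X (-1) 0 \<union> (X 0 1 \<union> X 0 (-1))"
    by (auto simp: X_def neighbours_def)
  have disj: "X a b \<inter> X a' b' = {}" if "a \<noteq> a' \<or> b \<noteq> b'" for a b a' b'
    using that by (auto simp: X_def)
  have "card {(c, d). c \<in> P \<and> d \<in> neighbours c \<and> d \<notin> P}
      = (card (X 1 0) + card (X (-1) 0)) + (card (X 0 1) + card (X 0 (-1)))"
    unfolding eq by (simp add: card_Un_disjoint finX disj Int_Un_distrib Int_Un_distrib2)
  moreover have "card (X a b) = card (X (-a) (-b))" for a b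
    unfolding cardX using card_exits_opposite[OF fin, of "(a, b)"]
    by (simp add: plus_prod_def minus_prod_def)
  from this[of 1 0] this[of 0 1] have "card (X 1 0) = card (X (-1) 0)" "card (X 0 1) = card (X 0 (-1))"
    by simp_all
  ultimately show ?thesis by (simp add: perimeter_def P_def)
qed

lemma finite_motzkin_words: "finite (motzkin_words n i)"
proof -
  have bound: "w ! k \<le> k + 1" if "motzkin_word w" "k < length w" for w k
    using that(2)
  proof (induction k)
    case 0
    then show ?case using that(1) by (simp add: motzkin_word_def)
  next
    case (Suc k)
    then have "w ! Suc k \<le> w ! k + 1"
      using that(1) unfolding motzkin_word_def by (metis diff_Suc_1 le_add1 plus_1_eq_Suc)
    then show ?case using Suc by simp
  qed
  have "motzkin_words n i \<subseteq> {w. set w \<subseteq> {..n} \<and> length w = n}"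
    using bound by (fastforce simp: motzkin_words_def in_set_conv_nth)
  then show ?thesis
    by (rule finite_subset) (simp add: finite_lists_length_eq)
qed

section \<open>The generating function\<close>

text \<open>Formal power series in \<open>p\<close>, \<open>x\<close>, \<open>v\<close> over the rationals are iterated univariate series:
  \<open>v\<close> is the variable of the outermost layer, \<open>x\<close> of the middle one, \<open>p\<close> of the innermost one.\<close>

type_synonym fps3 = "rat fps fps fps"

definition var_p :: fps3 where "var_p = fps_const (fps_const fps_X)"
definition var_x :: fps3 where "var_x = fps_const fps_X"
definition var_v :: fps3 where "var_v = fps_X"

text \<open>The coefficient of \<open>v^j\<close> belongs to the words with last letter \<open>j + 1\<close>.
  There are no Motzkin words of length 0, so the coefficient of \<open>x^0\<close> vanishes.\<close>

definition motzkin_gf :: fps3 where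
  "motzkin_gf = Abs_fps (\<lambda>j. Abs_fps (\<lambda>n. \<Sum>w\<in>motzkin_words n (j + 1). fps_X ^ sper w))"

text \<open>The square root of a series with constant term 1 is the one that has constant term 1;
  it exists and is unique by \<open>sqrt3_ex1\<close> below.\<close>

definition sqrt3 :: "fps3 \<Rightarrow> fps3" where
  "sqrt3 f = (THE g. g ^ 2 = f \<and> fps_nth (fps_nth (fps_nth g 0) 0) 0 = 1)"

fun sqrt_coeff :: "'a::comm_ring_1 fps \<Rightarrow> 'a \<Rightarrow> 'a \<Rightarrow> nat \<Rightarrow> 'a" where
  "sqrt_coeff f a c 0 = a"
| "sqrt_coeff f a c (Suc n) =
     c * (fps_nth f (Suc n) - (\<Sum>i\<in>{1..n}. sqrt_coeff f a c i * sqrt_coeff f a c (Suc n - i)))"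

lemma fps_square_root_exists:
  fixes f :: "'a::comm_ring_1 fps"
  assumes "a ^ 2 = fps_nth f 0" and "2 * a * c = 1"
  shows "\<exists>g. g ^ 2 = f \<and> fps_nth g 0 = a"
proof -
  let ?s = "sqrt_coeff f a c"
  have "Abs_fps ?s ^ 2 = f"
  proof (rule fps_ext)
    fix n
    show "fps_nth (Abs_fps ?s ^ 2) n = fps_nth f n"
    proof (cases n)
      case 0
      then show ?thesis using assms(1) by (simp add: power2_eq_square fps_mult_nth)
    next
      case (Suc m)
      let ?S = "\<Sum>i\<in>{1..m}. ?s i * ?s (Suc m - i)"
      have "fps_nth (Abs_fps ?s ^ 2) n = (\<Sum>i\<in>{0..Suc m}. ?s i * ?s (Suc m - i))"
        by (simp add: Suc power2_eq_square fps_mult_nth del: sqrt_coeff.simps)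
      also have "\<dots> = ?s 0 * ?s (Suc m) + (\<Sum>i\<in>{1..Suc m}. ?s i * ?s (Suc m - i))"
        by (simp add: sum.atLeast_Suc_atMost del: sqrt_coeff.simps)
      also have "(\<Sum>i\<in>{1..Suc m}. ?s i * ?s (Suc m - i)) = ?S + ?s (Suc m) * ?s 0"
        by (subst sum.cl_ivl_Suc) (simp del: sqrt_coeff.simps)
      also have "?s 0 * ?s (Suc m) + (?S + ?s (Suc m) * ?s 0)
          = (2 * a * c) * (fps_nth f (Suc m) - ?S) + ?S"
        by (simp add: algebra_simps)
      finally show ?thesis using assms(2) Suc by simp
    qed
  qed
  then show ?thesis by (intro exI[of _ "Abs_fps ?s"]) simp
qed

lemma fps_unit_if_nth_0_unit:
  fixes f :: "'a::comm_ring_1 fps"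
  assumes "fps_nth f 0 * y = 1"
  shows "f * fps_right_inverse f y = 1"
  by (rule fps_right_inverse) (rule assms)

lemma sqrt3_ex1:
  assumes "fps_nth (fps_nth (fps_nth f 0) 0) 0 = 1"
  shows "\<exists>!g::fps3. g ^ 2 = f \<and> fps_nth (fps_nth (fps_nth g 0) 0) 0 = 1"
proof (rule ex_ex1I)
  obtain g0 where g0: "g0 ^ 2 = fps_nth (fps_nth f 0) 0" "fps_nth g0 0 = 1"
    using fps_square_root_exists[of 1 "fps_nth (fps_nth f 0) 0" "1 / 2"] assms by auto
  define c0 where "c0 = inverse (2 * g0)"
  have c0: "2 * g0 * c0 = 1"
    unfolding c0_def using g0(2) by (intro inverse_mult_eq_1') (simp add: numeral_fps_const)
  obtain g1 where g1: "g1 ^ 2 = fps_nth f 0" "fps_nth g1 0 = g0"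
    using fps_square_root_exists[OF g0(1) c0] by auto
  obtain c1 where c1: "2 * g1 * c1 = 1"
  proof -
    have "fps_nth (2 * g1) 0 * c0 = 1"
      using c0 g1(2) by (simp add: numeral_fps_const)
    then show thesis using fps_unit_if_nth_0_unit that by blast
  qed
  show "\<exists>g::fps3. g ^ 2 = f \<and> fps_nth (fps_nth (fps_nth g 0) 0) 0 = 1"
    using fps_square_root_exists[OF g1(1) c1] g1(2) g0(2) by auto
next
  fix g h :: fps3
  assume g: "g ^ 2 = f \<and> fps_nth (fps_nth (fps_nth g 0) 0) 0 = 1"
    and h: "h ^ 2 = f \<and> fps_nth (fps_nth (fps_nth h 0) 0) 0 = 1"
  then have "g ^ 2 = h ^ 2" by simp
  then have "g = h \<or> g = - h" by (rule power2_eq_iff[THEN iffD1])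
  then show "g = h"
  proof
    assume "g = - h"
    then have "fps_nth (fps_nth (fps_nth g 0) 0) 0 = - fps_nth (fps_nth (fps_nth h 0) 0) 0" by simp
    with g h show ?thesis by simp
  qed
qed

text \<open>Division on iterated power series multiplies by the inverse only if the constant
  coefficient is a unit of the coefficient ring. The next lemma confirms that division by the
  denominator of the closed form is genuine division.\<close>

lemma denominator_divide:
  fixes f :: fps3
  defines "D \<equiv> 2 * (1 + var_p * var_x + var_p ^ 2 * var_v ^ 2 * var_x - var_v * (1 + var_p ^ 2 * var_x))"
  shows "f / D * D = f"
proof -
  let ?d = "2 * (1 + fps_const fps_X * fps_X) :: rat fps fps"
  have D0: "fps_nth D 0 = ?d"
    by (simp add: D_def var_p_def var_x_def var_v_def numeral_fps_const)
  have d0: "fps_nth ?d 0 = 2"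
    by (simp add: numeral_fps_const)
  have two: "(2 :: rat fps) * inverse 2 = 1"
    by (rule inverse_mult_eq_1') (simp add: numeral_fps_const)
  have inv: "?d * inverse ?d = 1"
    unfolding fps_inverse_def[of ?d] by (rule fps_unit_if_nth_0_unit) (simp only: d0 two)
  have "D * inverse D = 1"
    unfolding fps_inverse_def[of D] by (rule fps_unit_if_nth_0_unit) (simp only: D0 inv)
  moreover have "f / D = f * inverse D"
  proof (rule fps_divide_unit)
    have "fps_nth (fps_nth D 0) 0 \<noteq> 0"
      unfolding D0 d0 using two by force
    then show "fps_nth D 0 \<noteq> 0" by auto
  qed
  ultimately show ?thesis by (simp add: ac_simps)
qed

end

theory Submission
  imports Defs
begin

text \<open>
  Every ascent of a Motzkin word is by exactly one, and the semiperimeter of a bargraph is its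
  number of columns plus its total ascent (\<open>sper_eq_length_plus_ascents\<close>). Appending a letter \<open>i\<close>
  therefore multiplies the weight of a word by \<open>p\<^sup>2 x\<close> if the word ended in \<open>i - 1\<close>, and by \<open>p x\<close>
  if it ended in a larger letter than \<open>i\<close>.

  Let \<open>a\<^sub>i\<close> be the series in \<open>x\<close> and \<open>p\<close> of the words with last letter \<open>i\<close>, and put \<open>a\<^sub>0 = 1\<close> for the
  empty word. The rule for appending a letter expresses \<open>a\<^sub>i\<close> by \<open>a\<^sub>i\<^sub>-\<^sub>1\<close> and the sum of all \<open>a\<^sub>j\<close> with
  \<open>j > i\<close>; subtracting the expressions for \<open>i + 1\<close> and \<open>i + 2\<close> leaves a linear recurrence of order two,
  \<open>(1 + p x) a\<^sub>i\<^sub>+\<^sub>2 = (1 + p\<^sup>2 x) a\<^sub>i\<^sub>+\<^sub>1 - p\<^sup>2 x a\<^sub>i\<close> (\<open>last_gf_recurrence\<close>). Summed against powers of \<open>v\<close>, it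
  says that the product of the generating function and the kernel
  \<open>1 + p x - (1 + p\<^sup>2 x) v + p\<^sup>2 x v\<^sup>2\<close> is \<open>(1 + p x) a\<^sub>1 - p\<^sup>2 x v\<close>
  (\<open>denominator_times_motzkin_gf\<close>), so that only \<open>a\<^sub>1\<close> is left to find.

  The recurrence has a solution for any value of \<open>a\<^sub>1\<close>; the right value is singled out by the fact
  that a letter \<open>i\<close> needs at least \<open>i\<close> columns, so \<open>x\<^sup>i\<close> divides \<open>a\<^sub>i\<close>. Along the recurrence
  \<open>a\<^sub>i\<^sub>+\<^sub>1\<^sup>2 - a\<^sub>i a\<^sub>i\<^sub>+\<^sub>2\<close> is multiplied by \<open>p\<^sup>2 x / (1 + p x)\<close> in each step, so it gains one factor \<open>x\<close>,
  whereas the divisibility makes it gain two. Hence it vanishes (\<open>casoratian_vanishes\<close>),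
  \<open>a\<^sub>2 = a\<^sub>1\<^sup>2\<close>, and the recurrence at \<open>i = 0\<close> becomes a quadratic equation for \<open>a\<^sub>1\<close>. Its discriminant is
  the radicand of the closed form, and the square root with constant term 1 is
  \<open>1 + p\<^sup>2 x - 2 (1 + p x) a\<^sub>1\<close>.
\<close>

section \<open>The semiperimeter of a word\<close>

text \<open>Each row has as many right ends as left ends, and each column as many lower ends as upper
  ends, so it is enough to count the borders in two of the four directions.\<close>

lemma perimeter_eq_two_exits:
  assumes fin: "finite P"
  shows "perimeter P = 2 * (card {c \<in> P. c - (1, 0) \<notin> P} + card {c \<in> P. c + (0, 1) \<notin> P})"
proof -
  define X where "X e = (\<lambda>c. (c, c + e)) ` {c \<in> P. c + e \<notin> P}" for e :: "int \<times> int"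
  have finX: "finite (X e)" for e using fin by (simp add: X_def)
  have cardX: "card (X e) = card {c \<in> P. c + e \<notin> P}" for e
    unfolding X_def by (intro card_image inj_onI) auto
  have disj: "X e \<inter> X e' = {}" if "e \<noteq> e'" for e e'
    using that by (auto simp: X_def)
  have "{(c, d). c \<in> P \<and> d \<in> neighbours c \<and> d \<notin> P}
      = X (1, 0) \<union> X (- (1, 0)) \<union> (X (0, 1) \<union> X (- (0, 1)))"
    by (auto simp: X_def neighbours_def plus_prod_def)
  then have "perimeter P = (card (X (1, 0)) + card (X (- (1, 0))))
      + (card (X (0, 1)) + card (X (- (0, 1))))"
    by (simp add: perimeter_def card_Un_disjoint finX disj Int_Un_distrib Int_Un_distrib2)
  moreover have "card (X e) + card (X (- e)) = 2 * card {c \<in> P. c - e \<notin> P}" for e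
    using card_exits_opposite[OF fin, of e] unfolding cardX diff_conv_add_uminus by linarith
  ultimately show ?thesis
    unfolding card_exits_opposite[OF fin, of "(0, 1)"] by (simp only: distrib_left)
qed

lemma cell_iff: "(int k, int j) \<in> polyomino w \<longleftrightarrow> k < length w \<and> j < w ! k"
  by (auto simp: polyomino_def)

text \<open>Every nonempty column has one top border, and column \<open>k\<close> shows its left borders exactly at
  the heights that column \<open>k - 1\<close> does not reach. The difference is truncated, so a descent
  contributes nothing.\<close>

lemma sper_eq_length_plus_ascents:
  assumes pos: "\<And>k. k < length w \<Longrightarrow> 0 < w ! k"
  shows "sper w = length w + (\<Sum>k<length w. w ! k - (if k = 0 then 0 else w ! (k - 1)))"
proof -
  let ?P = "polyomino w"
  define prev where "prev k = (if k = 0 then 0 else w ! (k - 1))" for k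
  let ?emb = "\<lambda>(k, j). (int k, int j)"
  have inj: "inj_on ?emb S" for S
    by (auto simp: inj_on_def)
  have left: "(int k - 1, int j) \<notin> ?P \<longleftrightarrow> prev k \<le> j" if "k < length w" for k j
  proof (cases k)
    case 0
    then show ?thesis by (auto simp: polyomino_def prev_def)
  next
    case (Suc m)
    then show ?thesis using that cell_iff[of m j w] by (auto simp: prev_def)
  qed
  have up: "(int k, int j + 1) \<notin> ?P \<longleftrightarrow> w ! k \<le> Suc j" if "k < length w" for k j
    using that cell_iff[of k "Suc j" w] by (auto simp: add.commute)
  have card_cells: "card {c \<in> ?P. Q c} = (\<Sum>k<length w. card {j. j < w ! k \<and> Q (int k, int j)})" for Q
  proof -
    have "{c \<in> ?P. Q c} = ?emb ` (SIGMA k:{..<length w}. {j. j < w ! k \<and> Q (int k, int j)})"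
      by (force simp: polyomino_def)
    then show ?thesis by (simp add: card_image[OF inj])
  qed
  have "card {c \<in> ?P. c - (1, 0) \<notin> ?P} = (\<Sum>k<length w. w ! k - prev k)"
    unfolding card_cells
  proof (rule sum.cong[OF refl])
    fix k assume "k \<in> {..<length w}"
    then have "{j. j < w ! k \<and> (int k, int j) - (1, 0) \<notin> ?P} = {prev k..<w ! k}"
      using left by auto
    then show "card {j. j < w ! k \<and> (int k, int j) - (1, 0) \<notin> ?P} = w ! k - prev k" by simp
  qed
  moreover have "card {c \<in> ?P. c + (0, 1) \<notin> ?P} = (\<Sum>k<length w. 1)"
    unfolding card_cells
  proof (rule sum.cong[OF refl])
    fix k assume "k \<in> {..<length w}"
    then have "{j. j < w ! k \<and> (int k, int j) + (0, 1) \<notin> ?P} = {w ! k - 1}"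
      using up pos[of k] by auto
    then show "card {j. j < w ! k \<and> (int k, int j) + (0, 1) \<notin> ?P} = 1" by simp
  qed
  ultimately show ?thesis
    by (simp add: sper_def perimeter_eq_two_exits[OF finite_polyomino] prev_def)
qed

lemma sper_snoc:
  assumes pos: "\<And>k. k < length w \<Longrightarrow> 0 < w ! k" and "w \<noteq> []" "0 < i"
  shows "sper (w @ [i]) = sper w + 1 + (i - last w)"
proof -
  have "sper (w @ [i]) = length (w @ [i]) + (\<Sum>k<length (w @ [i]).
      (w @ [i]) ! k - (if k = 0 then 0 else (w @ [i]) ! (k - 1)))"
    by (rule sper_eq_length_plus_ascents) (use assms in \<open>auto simp: nth_append\<close>)
  also have "(\<Sum>k<length (w @ [i]). (w @ [i]) ! k - (if k = 0 then 0 else (w @ [i]) ! (k - 1)))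
      = (\<Sum>k<length w. w ! k - (if k = 0 then 0 else w ! (k - 1))) + (i - last w)"
    using \<open>w \<noteq> []\<close> by (auto simp: nth_append last_conv_nth intro!: sum.cong)
  finally show ?thesis
    using sper_eq_length_plus_ascents[OF pos] by simp
qed

section \<open>Appending a letter\<close>

lemma motzkin_word_nth_pos: "motzkin_word w \<Longrightarrow> k < length w \<Longrightarrow> 0 < w ! k"
  by (cases k) (auto simp: motzkin_word_def Suc_le_eq dest: spec[of _ k])

lemma motzkin_word_nth_le: "motzkin_word w \<Longrightarrow> k < length w \<Longrightarrow> w ! k \<le> Suc k"
proof (induction k)
  case 0
  then show ?case by (simp add: motzkin_word_def)
next
  case (Suc k)
  then have "w ! Suc k \<le> w ! k + 1"
    unfolding motzkin_word_def by (metis diff_Suc_1 le_add1 plus_1_eq_Suc)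
  then show ?case using Suc by simp
qed

lemma motzkin_word_snoc:
  assumes "w \<noteq> []"
  shows "motzkin_word (w @ [i]) \<longleftrightarrow> motzkin_word w \<and> 1 \<le> i \<and> i \<le> last w + 1 \<and> last w \<noteq> i"
proof -
  have last_index: "(\<forall>k. 1 \<le> k \<and> k < Suc n \<longrightarrow> Q k) \<longleftrightarrow> (\<forall>k. 1 \<le> k \<and> k < n \<longrightarrow> Q k) \<and> Q n"
    if "1 \<le> n" for n and Q :: "nat \<Rightarrow> bool"
    using that by (auto simp: less_Suc_eq)
  let ?ok = "\<lambda>u k. 1 \<le> u ! k \<and> u ! k \<le> u ! (k - 1) + 1 \<and> u ! (k - 1) \<noteq> u ! k"
  have "(\<forall>k. 1 \<le> k \<and> k < length (w @ [i]) \<longrightarrow> ?ok (w @ [i]) k) \<longleftrightarrow>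
      (\<forall>k. 1 \<le> k \<and> k < length w \<longrightarrow> ?ok (w @ [i]) k) \<and> ?ok (w @ [i]) (length w)"
    unfolding length_append_singleton by (rule last_index) (use assms in \<open>simp add: Suc_le_eq\<close>)
  also have "(\<forall>k. 1 \<le> k \<and> k < length w \<longrightarrow> ?ok (w @ [i]) k) \<longleftrightarrow>
      (\<forall>k. 1 \<le> k \<and> k < length w \<longrightarrow> ?ok w k)"
    by (intro all_cong imp_cong refl) (simp add: nth_append less_imp_diff_less)
  also have "?ok (w @ [i]) (length w) \<longleftrightarrow> 1 \<le> i \<and> i \<le> last w + 1 \<and> last w \<noteq> i"
    using assms by (simp add: nth_append last_conv_nth)
  finally show ?thesis
    using assms unfolding motzkin_word_def by (simp add: nth_append)
qed

lemma motzkin_words_1: "motzkin_words 1 i = (if i = 1 then {[1]} else {})"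
  by (auto simp: motzkin_words_def motzkin_word_def length_Suc_conv)

lemma motzkin_words_eq_empty:
  assumes "i = 0 \<or> n < i"
  shows "motzkin_words n i = {}"
proof -
  have "0 < last w \<and> last w \<le> length w" if "motzkin_word w" for w
  proof -
    have "w \<noteq> []" using that by (simp add: motzkin_word_def)
    then show ?thesis
      using motzkin_word_nth_pos[OF that, of "length w - 1"]
        motzkin_word_nth_le[OF that, of "length w - 1"]
      by (simp add: last_conv_nth)
  qed
  then show ?thesis using assms by (fastforce simp: motzkin_words_def)
qed

text \<open>The penultimate letter is either \<open>i - 1\<close> or larger than \<open>i\<close>; it is at most \<open>n\<close> because a word
  gains at most one per column.\<close>

lemma motzkin_words_Suc:
  assumes "0 < n" "0 < i"
  shows "motzkin_words (Suc n) i =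
    (\<lambda>w. w @ [i]) ` (\<Union>j \<in> insert (i - 1) {i + 1..n}. motzkin_words n j)"
proof (intro equalityI subsetI)
  fix u assume u: "u \<in> motzkin_words (Suc n) i"
  then obtain w where w: "u = w @ [i]" "length w = n"
    by (cases u rule: rev_cases) (auto simp: motzkin_words_def)
  then have "w \<noteq> []" using assms by auto
  then have mw: "motzkin_word w" "i \<le> last w + 1" "last w \<noteq> i"
    using u w motzkin_word_snoc by (auto simp: motzkin_words_def)
  then have m: "w \<in> motzkin_words n (last w)"
    using w by (simp add: motzkin_words_def)
  then have "last w \<le> n"
    using motzkin_words_eq_empty[of "last w" n] by force
  then have "last w \<in> insert (i - 1) {i + 1..n}"
    using mw by auto
  then show "u \<in> (\<lambda>w. w @ [i]) ` (\<Union>j \<in> insert (i - 1) {i + 1..n}. motzkin_words n j)"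
    using m w by blast
next
  fix u assume "u \<in> (\<lambda>w. w @ [i]) ` (\<Union>j \<in> insert (i - 1) {i + 1..n}. motzkin_words n j)"
  then obtain j w where w: "u = w @ [i]" "w \<in> motzkin_words n j" "j \<in> insert (i - 1) {i + 1..n}"
    by blast
  moreover from w have "w \<noteq> []" using assms by (auto simp: motzkin_words_def)
  ultimately show "u \<in> motzkin_words (Suc n) i"
    using assms by (auto simp: motzkin_words_def motzkin_word_snoc)
qed

section \<open>The series of words with a given last letter\<close>

text \<open>The empty word is counted as ending in 0. Since the letter 1 is one more than 0, the word \<open>[1]\<close>
  then arises from it by the same rule as every longer word from its prefix.\<close>

definition last_weight :: "nat \<Rightarrow> nat \<Rightarrow> rat fps" where
  "last_weight i n =
     (if n = 0 then of_bool (i = 0) else \<Sum>w\<in>motzkin_words n i. fps_X ^ sper w)"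

definition last_gf :: "nat \<Rightarrow> rat fps fps" where
  "last_gf i = Abs_fps (last_weight i)"

lemma last_weight_eq_0: "n < i \<Longrightarrow> last_weight i n = 0"
  by (simp add: last_weight_def motzkin_words_eq_empty)

lemma last_gf_0: "last_gf 0 = 1"
  by (rule fps_ext) (simp add: last_gf_def last_weight_def motzkin_words_eq_empty)

lemma last_weight_Suc:
  assumes "0 < i"
  shows "last_weight i (Suc n) =
    fps_X ^ 2 * last_weight (i - 1) n + fps_X * (\<Sum>j = i + 1..n. last_weight j n)"
proof (cases "n = 0")
  case True
  have "sper [1] = 2"
    using sper_eq_length_plus_ascents[of "[1]"] by simp
  then show ?thesis
    using assms True motzkin_words_1[of i] by (auto simp: last_weight_def)
next
  case False
  let ?J = "insert (i - 1) {i + 1..n}"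
  have "(\<Sum>u\<in>motzkin_words (Suc n) i. fps_X ^ sper u :: rat fps)
      = (\<Sum>w\<in>(\<Union>j\<in>?J. motzkin_words n j). fps_X ^ sper (w @ [i]))"
    using False assms by (subst motzkin_words_Suc) (simp_all add: sum.reindex inj_on_def)
  also have "\<dots> = (\<Sum>j\<in>?J. \<Sum>w\<in>motzkin_words n j. fps_X ^ sper (w @ [i]))"
    by (rule sum.UNION_disjoint)
      (use finite_motzkin_words in \<open>auto simp: motzkin_words_def\<close>)
  also have "\<dots> = (\<Sum>j\<in>?J. fps_X ^ (1 + (i - j)) * last_weight j n)"
  proof (rule sum.cong[OF refl])
    fix j
    have "sper (w @ [i]) = 1 + (i - j) + sper w" if "w \<in> motzkin_words n j" for w
      using that False assms motzkin_word_nth_pos[of w]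
      by (subst sper_snoc) (auto simp: motzkin_words_def)
    then show "(\<Sum>w\<in>motzkin_words n j. fps_X ^ sper (w @ [i]) :: rat fps)
        = fps_X ^ (1 + (i - j)) * last_weight j n"
      using False by (simp add: last_weight_def sum_distrib_left power_add mult.assoc)
  qed
  also have "\<dots> = fps_X ^ 2 * last_weight (i - 1) n
      + (\<Sum>j = i + 1..n. fps_X ^ (1 + (i - j)) * last_weight j n)"
    using assms by (subst sum.insert) (auto simp: power2_eq_square)
  also have "(\<Sum>j = i + 1..n. fps_X ^ (1 + (i - j)) * last_weight j n)
      = fps_X * (\<Sum>j = i + 1..n. last_weight j n)"
    by (simp add: sum_distrib_left)
  finally show ?thesis
    by (simp add: last_weight_def)
qed

text \<open>The sums over all larger letters in \<open>last_weight_Suc\<close> for \<open>i + 1\<close> and for \<open>i + 2\<close> differ by a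
  single term, so the difference of the two equations contains no sum.\<close>

lemma last_gf_recurrence:
  "(1 + fps_const fps_X * fps_X) * last_gf (i + 2) =
   (1 + fps_const (fps_X ^ 2) * fps_X) * last_gf (i + 1) - fps_const (fps_X ^ 2) * fps_X * last_gf i"
proof (rule fps_ext)
  fix n
  have nth: "fps_nth (fps_const e * fps_X * last_gf j) n
      = (if n = 0 then 0 else e * last_weight j (n - 1))" for e j
    by (simp add: last_gf_def mult.assoc)
  have step: "last_weight (i + 2) (Suc m) + fps_X * last_weight (i + 2) m
      = last_weight (i + 1) (Suc m) + fps_X ^ 2 * last_weight (i + 1) m - fps_X ^ 2 * last_weight i m" for m
  proof -
    have "(\<Sum>j = i + 2..m. last_weight j m) = last_weight (i + 2) m + (\<Sum>j = i + 3..m. last_weight j m)"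
    proof (cases "i + 2 \<le> m")
      case True
      then show ?thesis by (simp add: sum.atLeast_Suc_atMost numeral_3_eq_3)
    qed (simp add: last_weight_eq_0)
    then show ?thesis
      by (simp add: last_weight_Suc algebra_simps numeral_3_eq_3)
  qed
  have "fps_nth (last_gf (i + 2) + fps_const fps_X * fps_X * last_gf (i + 2)) n
     = fps_nth (last_gf (i + 1) + fps_const (fps_X ^ 2) * fps_X * last_gf (i + 1)
         - fps_const (fps_X ^ 2) * fps_X * last_gf i) n"
    unfolding fps_add_nth fps_sub_nth nth
    using step[of "n - 1"] by (cases n) (simp_all add: last_gf_def last_weight_def)
  then show "fps_nth ((1 + fps_const fps_X * fps_X) * last_gf (i + 2)) n
     = fps_nth ((1 + fps_const (fps_X ^ 2) * fps_X) * last_gf (i + 1)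
         - fps_const (fps_X ^ 2) * fps_X * last_gf i) n"
    by (simp add: distrib_right)
qed

text \<open>Let \<open>W i = a (i + 1) ^ 2 - a i * a (i + 2)\<close>, up to sign the Casoratian of the solution and its
  shift, which vanishes on geometric sequences. The recurrence gives
  \<open>c ^ n * W n = (e X) ^ n * W 0\<close>. The left side is divisible by \<open>X ^ (2 n + 2)\<close>; comparing the coefficients of \<open>X ^ (2 n)\<close> shows that coefficient \<open>n\<close> of \<open>W 0\<close> vanishes.\<close>

lemma casoratian_vanishes:
  fixes a :: "nat \<Rightarrow> 'a::idom fps"
  assumes rec: "\<And>i. c * a (i + 2) = b * a (i + 1) - fps_const e * fps_X * a i"
    and small: "\<And>i n. n < i \<Longrightarrow> fps_nth (a i) n = 0"
    and "e \<noteq> 0"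
  shows "a 1 ^ 2 = a 0 * a 2"
proof -
  define d where "d = fps_const e * fps_X"
  define W where "W i = a (i + 1) ^ 2 - a i * a (i + 2)" for i
  have step: "c * W (Suc i) = d * W i" for i
  proof -
    have "c * W (Suc i) = a (i + 2) * (c * a (i + 2)) - a (i + 1) * (c * a (i + 3))"
      by (simp add: W_def power2_eq_square algebra_simps numeral_3_eq_3)
    also have "c * a (i + 3) = b * a (i + 2) - d * a (i + 1)"
      using rec[of "i + 1"] by (simp add: d_def numeral_3_eq_3)
    also have "c * a (i + 2) = b * a (i + 1) - d * a i"
      using rec[of i] by (simp add: d_def)
    finally show ?thesis by (simp add: W_def power2_eq_square algebra_simps)
  qed
  have pow: "c ^ m * W m = d ^ m * W 0" for m
  proof (induction m)
    case (Suc m)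
    have "c ^ Suc m * W (Suc m) = c ^ m * (c * W (Suc m))" by (simp add: ac_simps)
    also have "\<dots> = d * (c ^ m * W m)" by (simp only: step ac_simps)
    finally show ?case unfolding Suc by (simp add: mult.assoc)
  qed simp
  have prod_small: "fps_nth (f * g) n = 0"
    if "\<And>l. l < i \<Longrightarrow> fps_nth f l = 0" "\<And>l. l < j \<Longrightarrow> fps_nth g l = 0" "n < i + j"
    for f g :: "'a fps" and i j n
    unfolding fps_mult_nth
  proof (rule sum.neutral, rule ballI)
    fix k assume "k \<in> {0..n}"
    then have "k < i \<or> n - k < j" using that(3) by auto
    then show "fps_nth f k * fps_nth g (n - k) = 0" using that(1,2) by auto
  qed
  have "W 0 = 0"
  proof (rule fps_ext)
    fix n
    have "fps_nth (W n) l = 0" if "l < 2 * n + 2" for l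
    proof -
      have "fps_nth (a (n + 1) * a (n + 1)) l = 0"
        by (rule prod_small[of "n + 1" _ "n + 1"]) (use small that in auto)
      moreover have "fps_nth (a n * a (n + 2)) l = 0"
        by (rule prod_small[of n _ "n + 2"]) (use small that in auto)
      ultimately show ?thesis by (simp add: W_def power2_eq_square)
    qed
    then have "fps_nth (c ^ n * W n) (2 * n) = 0"
      using prod_small[of 0 "c ^ n" "2 * n + 2" "W n" "2 * n"] by simp
    moreover have "d ^ n * W 0 = fps_X ^ n * (fps_const (e ^ n) * W 0)"
      by (simp add: d_def power_mult_distrib ac_simps flip: fps_const_power)
    ultimately have "e ^ n * fps_nth (W 0) n = 0"
      by (simp add: pow fps_X_power_mult_nth)
    then show "fps_nth (W 0) n = fps_nth 0 n" using \<open>e \<noteq> 0\<close> by simp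
  qed
  then show ?thesis by (simp add: W_def numeral_2_eq_2)
qed

section \<open>The closed form\<close>

lemma last_gf_1_quadratic:
  "(1 + fps_const fps_X * fps_X) * last_gf 1 ^ 2 =
   (1 + fps_const (fps_X ^ 2) * fps_X) * last_gf 1 - fps_const (fps_X ^ 2) * fps_X"
proof -
  have "last_gf 1 ^ 2 = last_gf 0 * last_gf 2"
    by (rule casoratian_vanishes[OF last_gf_recurrence])
      (simp_all add: last_gf_def last_weight_eq_0)
  then show ?thesis
    using last_gf_recurrence[of 0] by (simp add: last_gf_0 numeral_2_eq_2)
qed

lemma sqrt3_eqI:
  assumes "g ^ 2 = f" "fps_nth (fps_nth (fps_nth g 0) 0) 0 = 1"
  shows "sqrt3 f = g"
proof -
  have "fps_nth (fps_nth (fps_nth f 0) 0) 0 = 1"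
    using assms by (simp add: power2_eq_square flip: assms(1))
  from sqrt3_ex1[OF this] show ?thesis
    unfolding sqrt3_def by (rule the1_equality) (use assms in simp)
qed

text \<open>The kernel is the characteristic polynomial of \<open>last_gf_recurrence\<close> in the variable \<open>1 / v\<close>,
  cleared of denominators, so the recurrence cancels every coefficient of \<open>v ^ 2\<close> and beyond. As
  \<open>motzkin_gf\<close> lacks the term \<open>last_gf 0 = 1\<close>, the first instance of the recurrence leaves
  \<open>- var_p ^ 2 * var_x\<close> as the coefficient of \<open>v\<close>.\<close>

lemma denominator_times_motzkin_gf:
  "(1 + var_p * var_x + var_p ^ 2 * var_v ^ 2 * var_x - var_v * (1 + var_p ^ 2 * var_x)) * motzkin_gf
   = (1 + var_p * var_x) * fps_const (last_gf 1) - var_p ^ 2 * var_x * var_v"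
  (is "?K * _ = _")
proof (rule fps_ext)
  fix i
  let ?c = "1 + fps_const fps_X * fps_X :: rat fps fps"
  let ?d = "fps_const (fps_X ^ 2) * fps_X :: rat fps fps"
  have gf: "fps_nth motzkin_gf j = last_gf (j + 1)" for j
  proof (rule fps_ext)
    fix n
    show "fps_nth (fps_nth motzkin_gf j) n = fps_nth (last_gf (j + 1)) n"
      using motzkin_words_eq_empty[of "j + 1" 0]
      by (simp add: motzkin_gf_def last_gf_def last_weight_def)
  qed
  have c: "1 + var_p * var_x = fps_const ?c" and d: "var_p ^ 2 * var_x = fps_const ?d"
    by (simp_all add: var_p_def var_x_def flip: fps_const_add)
  have K: "?K * motzkin_gf = fps_const ?c * motzkin_gf
      - fps_X * (fps_const (1 + ?d) * motzkin_gf) + fps_X ^ 2 * (fps_const ?d * motzkin_gf)"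
  proof -
    have "?K = (1 + var_p * var_x) - fps_X * (1 + var_p ^ 2 * var_x) + fps_X ^ 2 * (var_p ^ 2 * var_x)"
      by (simp add: var_v_def algebra_simps)
    also have "\<dots> = fps_const ?c - fps_X * fps_const (1 + ?d) + fps_X ^ 2 * fps_const ?d"
      unfolding c d by (simp flip: fps_const_add)
    finally show ?thesis by (simp only: distrib_right left_diff_distrib mult.assoc)
  qed
  show "fps_nth (?K * motzkin_gf) i
      = fps_nth ((1 + var_p * var_x) * fps_const (last_gf 1) - var_p ^ 2 * var_x * var_v) i"
  proof -
    consider "i = 0" | "i = 1" | k where "i = k + 2"
      by (metis One_nat_def add_2_eq_Suc' not0_implies_Suc)
    then show ?thesis
    proof cases
      case 1
      then show ?thesis unfolding K unfolding c d by (simp add: gf var_v_def)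
    next
      case 2
      then show ?thesis unfolding K unfolding c d
        using last_gf_recurrence[of 0]
        by (simp add: gf var_v_def last_gf_0 fps_X_power_mult_nth numeral_2_eq_2 algebra_simps)
    next
      case 3
      then show ?thesis unfolding K unfolding c d
        using last_gf_recurrence[of "k + 1"]
        by (simp add: gf var_v_def fps_X_power_mult_nth)
    qed
  qed
qed

theorem theorem4p3:
  shows "motzkin_gf =
    (1 + var_p ^ 2 * (var_x - 2 * var_v * var_x)
       - sqrt3 (1 - 2 * var_p ^ 2 * var_x - 4 * var_p ^ 3 * var_x ^ 2 + var_p ^ 4 * var_x ^ 2))
    / (2 * (1 + var_p * var_x + var_p ^ 2 * var_v ^ 2 * var_x - var_v * (1 + var_p ^ 2 * var_x)))"
    (is "_ = ?N / (2 * ?K)")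
proof -
  define a where "a = fps_const (last_gf 1)"
  let ?S = "1 + var_p ^ 2 * var_x - 2 * (1 + var_p * var_x) * a"
  have "(1 + var_p * var_x) * a ^ 2 = (1 + var_p ^ 2 * var_x) * a - var_p ^ 2 * var_x"
  proof -
    have "fps_const ((1 + fps_const fps_X * fps_X) * last_gf 1 ^ 2) =
      fps_const ((1 + fps_const (fps_X ^ 2) * fps_X) * last_gf 1 - fps_const (fps_X ^ 2) * fps_X)"
      by (simp only: last_gf_1_quadratic)
    then show ?thesis
      by (simp add: a_def var_p_def var_x_def flip: fps_const_add fps_const_sub fps_const_mult fps_const_power)
  qed
  then have "?S ^ 2 = 1 - 2 * var_p ^ 2 * var_x - 4 * var_p ^ 3 * var_x ^ 2 + var_p ^ 4 * var_x ^ 2"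
    by algebra
  moreover have "fps_nth (fps_nth (fps_nth ?S 0) 0) 0 = 1"
    by (simp add: var_p_def var_x_def a_def last_gf_def last_weight_def)
  \<comment> \<open>\<open>?S\<close> is the constant-term-1 root of the discriminant of the quadratic equation for \<open>a\<close>.\<close>
  ultimately have "?N = 1 + var_p ^ 2 * (var_x - 2 * var_v * var_x) - ?S"
    by (simp only: sqrt3_eqI)
  also have "\<dots> = 2 * ((1 + var_p * var_x) * a - var_p ^ 2 * var_x * var_v)"
    by (simp add: algebra_simps)
  also have "\<dots> = motzkin_gf * (2 * ?K)"
    unfolding a_def denominator_times_motzkin_gf[symmetric] by (simp add: ac_simps)
  finally have "motzkin_gf * (2 * ?K) = ?N" ..
  moreover have "?N / (2 * ?K) * (2 * ?K) = ?N"
    by (rule denominator_divide)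
  moreover have "2 * ?K \<noteq> 0"
  proof
    assume "2 * ?K = 0"
    then have "fps_nth (fps_nth (fps_nth (2 * ?K) 0) 0) 0 = 0" by simp
    then show False
      by (simp add: var_p_def var_x_def var_v_def numeral_fps_const)
  qed
  ultimately show ?thesis
    by (metis mult_right_cancel)
qed

end
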